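(* Let $n$ be a nonzero integer, $p$ an odd prime, and $0\le k\le c+v-1$. A diagram for a balanced spatial graph $(G,\omega)$, with $c$ crossings, $v$ vertices and $e$ edges, will have more than $e-v+k$ linearly independent $p$-colorings at $n$ (i.e. $N_p(G,\omega,n)>e-v+k$) if and only if $p\mid \det_k(G,\omega)(n)$.
   Context: An oriented spatial graph $G$ is the image of an embedding in $\mathbb{R}^3\subset S^3$ of an abstract directed graph. A diagram $D$ of $G$ is a regular projection to a plane with over/under information; if $D$ has $c$ crossings, $v$ vertices and $e$ edges, then cutting the edges at undercrossings gives $c+e$ arcs. A weighting $\omega$ assigns to each edge an integer; it is balanced if at each vertex the sum of the weights of the edges directed in equals the sum of the weights of the edges directed out. A balanced spatial graph is a pair $(G,\omega)$ with $\omega$ balanced. The weight of an arc is that of the edge containing it. Alexander matrix $M(D,\omega)$: the $(c+v)\times(c+e)$ matrix over $\mathbb{Z}[t^{\pm1}]$ with one column per arc and one row per crossing and per vertex. It is a presentation matrix for the Alexander module of $(G,\omega)$. At a crossing with overarc $b$ of weight $w_1$ and underarcs $a$ (on the right of $b$) and $c$ (on the left of $b$), both of weight $w_2$, the row is given by the relation $(1-t^{w_2})b+t^{w_1}c-a=0$. At a vertex whose incident arc-ends, in clockwise order from an arbitrary starting point, are $a_1,\dots,a_n$ with weights $w_1,\dots,w_n$ and local signs $\varepsilon_i$ ($+1$ if directed into the vertex, $-1$ if directed out), the row is given by $\sum_{i}\varepsilon_i t^{m_i}a_i=0$, where $m_i=\varepsilon_1w_1+\cdots+\varepsilon_{i-1}w_{i-1}+\min\{\varepsilon_i,0\}w_i$.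 (Coefficients of the same arc are added; in this sentence and the previous one $c$ and $n$ are local notation for an arc and the number of arc-ends.) For a matrix $M$, $\det(M,k)$ is the greatest common divisor of all the $k\times k$ minors of $M$, with $\det(M,k)=1$ if $k\le 0$. For a nonzero integer $n$ and $0\le k\le c+v-1$, the $k$th determinant at $n$ of $(G,\omega)$ is $\det_k(G,\omega)(n)=\det(M(D,\omega)|_{t=n},\,c+v-k)$. The determinants at $n$ are regarded as well-defined up to multiplication by a power of $n$, and are typically normalized by factoring out the powers of $n$. The coloring matrix at $n$ is $C(D,\omega,n)=M(D,\omega)|_{t=n}$. For an odd prime $p$, a $p$-coloring of $D$ at $n$ is an assignment of an element of $\mathbb{Z}_p=\mathbb{Z}/p\mathbb{Z}$ to each arc (i.e. a vector in $\mathbb{Z}_p^{c+e}$) which is in the nullspace of $C(D,\omega,n)$ modulo $p$. $N_p(G,\omega,n)$, the number of linearly independent $p$-colorings, is the nullity of $C(D,\omega,n)$ over $\mathbb{Z}_p$; it does not depend on the choice of diagram.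
   Formalization: When p divides n, the coloring matrix at n is assumed to have no p in the denominators of its entries (else it has no meaning modulo p), and the kth determinant is taken literally, not up to powers of n; when p does not divide n, any power of n may be factored out. *)

theory Defs
  imports
    "HOL-Analysis.Analysis"
    "HOL-Library.Poly_Mapping"
    "Graph_Theory.Digraph"
    "Jordan_Normal_Form.Matrix_Kernel"
    "Jordan_Normal_Form.DL_Submatrix"
    "Berlekamp_Zassenhaus.Finite_Field"
begin

record ('v, 'e) spatial_graph =
  graph :: "('v, 'e) pre_digraph"
  pos :: "'v \<Rightarrow> real ^ 3"
  curve :: "'e \<Rightarrow> real \<Rightarrow> real ^ 3"

text \<open>
  The underlying directed graph is a finite multigraph, loops allowed. The last two conditions say
  that the map from the topological realisation of the graph to space is injective; by compactness
  it is then an embedding.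
\<close>

definition is_spatial_graph :: "('v, 'e, 'z) spatial_graph_scheme \<Rightarrow> bool" where
  "is_spatial_graph G \<longleftrightarrow>
     fin_digraph (graph G) \<and>
     inj_on (pos G) (verts (graph G)) \<and>
     (\<forall>e \<in> arcs (graph G).
        path (curve G e) \<and>
        pathstart (curve G e) = pos G (tail (graph G) e) \<and>
        pathfinish (curve G e) = pos G (head (graph G) e)) \<and>
     (\<forall>e \<in> arcs (graph G). \<forall>s \<in> {0<..<1}. \<forall>v \<in> verts (graph G). curve G e s \<noteq> pos G v) \<and>
     (\<forall>e \<in> arcs (graph G). \<forall>f \<in> arcs (graph G). \<forall>s \<in> {0<..<1}. \<forall>t \<in> {0<..<1}.
        curve G e s = curve G f t \<longrightarrow> e = f \<and> s = t)"

definition balanced :: "('v, 'e) pre_digraph \<Rightarrow> ('e \<Rightarrow> int) \<Rightarrow> bool" where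
  "balanced H \<omega> \<longleftrightarrow>
     (\<forall>v \<in> verts H. (\<Sum>e \<in> in_arcs H v. \<omega> e) = (\<Sum>e \<in> out_arcs H v. \<omega> e))"

text \<open>
  A strand is a point of an edge, given by the edge and its parameter. A crossing is the pair of
  its over- and its understrand. A pair \<open>(e, i)\<close> stands for the \<open>i\<close>-th of the pieces into which the
  edge \<open>e\<close> is cut at its undercrossings, counted from 0 in the direction of \<open>e\<close>.
\<close>

type_synonym 'e strand = "'e \<times> real"
type_synonym 'e crossing = "'e strand \<times> 'e strand"
type_synonym 'e diagram_arc = "'e \<times> nat"

datatype 'e arc_end = Incoming 'e | Outgoing 'e

text \<open>
  The plane of projection is spanned by the orthonormal vectors \<open>x_axis\<close>, \<open>y_axis\<close>, identified with
  1 and \<open>\<i>\<close>; it is viewed from the side of their cross product. The remaining fields are the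
  arbitrary choices that the Alexander matrix depends on: the orders of its rows and columns, and for
  each vertex the clockwise list of its arc-ends, whose head is the starting point.
\<close>

record ('v, 'e) diagram = "('v, 'e) spatial_graph" +
  x_axis :: "real ^ 3"
  y_axis :: "real ^ 3"
  crossing_list :: "'e crossing list"
  vertex_list :: "'v list"
  arc_list :: "'e diagram_arc list"
  end_list :: "'v \<Rightarrow> 'e arc_end list"

definition proj :: "('v, 'e) diagram \<Rightarrow> real ^ 3 \<Rightarrow> complex" where
  "proj D q = Complex (inner q (x_axis D)) (inner q (y_axis D))"

definition height :: "('v, 'e) diagram \<Rightarrow> real ^ 3 \<Rightarrow> real" where
  "height D q = inner q (cross3 (x_axis D) (y_axis D))"

definition shadow :: "('v, 'e) diagram \<Rightarrow> 'e \<Rightarrow> real \<Rightarrow> complex" where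
  "shadow D e t = proj D (curve D e t)"

definition has_velocity :: "('v, 'e) diagram \<Rightarrow> 'e \<Rightarrow> real \<Rightarrow> bool" where
  "has_velocity D e t \<longleftrightarrow> shadow D e differentiable (at t within {0..1})"

definition velocity :: "('v, 'e) diagram \<Rightarrow> 'e \<Rightarrow> real \<Rightarrow> complex" where
  "velocity D e t = vector_derivative (shadow D e) (at t within {0..1})"

definition strands :: "('v, 'e) diagram \<Rightarrow> 'e strand set" where
  "strands D = arcs (graph D) \<times> {0<..<1}"

definition crossings :: "('v, 'e) diagram \<Rightarrow> 'e crossing set" where
  "crossings D = {((e, s), (f, t)) | e s f t.
     (e, s) \<in> strands D \<and> (f, t) \<in> strands D \<and> shadow D e s = shadow D f t \<and>
     height D (curve D e s) > height D (curve D f t)}"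

text \<open>\<open>left_of z w\<close>: the vector \<open>w\<close> points to the left of the direction \<open>z\<close>.\<close>

definition left_of :: "complex \<Rightarrow> complex \<Rightarrow> bool" where
  "left_of z w \<longleftrightarrow> Im (cnj z * w) > 0"

definition ends_at :: "('v, 'e) diagram \<Rightarrow> 'v \<Rightarrow> 'e arc_end set" where
  "ends_at D v = Incoming ` in_arcs (graph D) v \<union> Outgoing ` out_arcs (graph D) v"

fun end_edge :: "'e arc_end \<Rightarrow> 'e" where
  "end_edge (Incoming e) = e"
| "end_edge (Outgoing e) = e"

fun end_param :: "'e arc_end \<Rightarrow> real" where
  "end_param (Incoming e) = 1"
| "end_param (Outgoing e) = 0"

fun end_sign :: "'e arc_end \<Rightarrow> int" where
  "end_sign (Incoming e) = 1"
| "end_sign (Outgoing e) = -1"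

text \<open>The direction in which an arc-end leaves its vertex, regardless of its orientation.\<close>

definition end_direction :: "('v, 'e) diagram \<Rightarrow> 'e arc_end \<Rightarrow> complex" where
  "end_direction D x = - of_int (end_sign x) * velocity D (end_edge x) (end_param x)"

definition regular_projection :: "('v, 'e) diagram \<Rightarrow> bool" where
  "regular_projection D \<longleftrightarrow>
     norm (x_axis D) = 1 \<and> norm (y_axis D) = 1 \<and> inner (x_axis D) (y_axis D) = 0 \<and>
     \<comment> \<open>the multiple points are finitely many transverse double points in the interior of edges\<close>
     finite (crossings D) \<and>
     (\<forall>((e, s), (f, t)) \<in> crossings D. has_velocity D e s \<and> has_velocity D f t \<and>
        Im (cnj (velocity D e s) * velocity D f t) \<noteq> 0) \<and>
     (\<forall>(e, s) \<in> strands D. \<forall>(f, t) \<in> strands D. \<forall>(g, u) \<in> strands D.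
        shadow D e s = shadow D f t \<and> shadow D f t = shadow D g u \<longrightarrow>
        (e, s) = (f, t) \<or> (f, t) = (g, u) \<or> (e, s) = (g, u)) \<and>
     inj_on (\<lambda>v. proj D (pos D v)) (verts (graph D)) \<and>
     (\<forall>v \<in> verts (graph D). \<forall>(e, s) \<in> strands D. shadow D e s \<noteq> proj D (pos D v)) \<and>
     \<comment> \<open>the arc-ends leave each vertex in pairwise different directions\<close>
     (\<forall>v \<in> verts (graph D).
        (\<forall>x \<in> ends_at D v. has_velocity D (end_edge x) (end_param x) \<and> end_direction D x \<noteq> 0) \<and>
        inj_on (\<lambda>x. Arg2pi (end_direction D x)) (ends_at D v))"

definition unders_before :: "('v, 'e) diagram \<Rightarrow> 'e \<Rightarrow> real \<Rightarrow> nat" where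
  "unders_before D e t = card {x \<in> crossings D. fst (snd x) = e \<and> snd (snd x) < t}"

definition diagram_arcs :: "('v, 'e) diagram \<Rightarrow> 'e diagram_arc set" where
  "diagram_arcs D = {(e, i) | e i. e \<in> arcs (graph D) \<and> i \<le> unders_before D e 1}"

definition end_arc :: "('v, 'e) diagram \<Rightarrow> 'e arc_end \<Rightarrow> 'e diagram_arc" where
  "end_arc D x = (end_edge x, unders_before D (end_edge x) (end_param x))"

text \<open>\<open>Arg2pi (d / d')\<close> is the clockwise angle from \<open>d\<close> to \<open>d'\<close>, in \<open>[0, 2\<pi>)\<close>.\<close>

definition clockwise :: "complex list \<Rightarrow> bool" where
  "clockwise ds \<longleftrightarrow> sorted_wrt (<) (map (\<lambda>d. Arg2pi (hd ds / d)) ds)"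

definition is_diagram :: "('v, 'e) diagram \<Rightarrow> bool" where
  "is_diagram D \<longleftrightarrow>
     is_spatial_graph D \<and> regular_projection D \<and>
     distinct (crossing_list D) \<and> set (crossing_list D) = crossings D \<and>
     distinct (vertex_list D) \<and> set (vertex_list D) = verts (graph D) \<and>
     distinct (arc_list D) \<and> set (arc_list D) = diagram_arcs D \<and>
     (\<forall>v \<in> verts (graph D).
        distinct (end_list D v) \<and> set (end_list D v) = ends_at D v \<and>
        clockwise (map (end_direction D) (end_list D v)))"

definition num_crossings :: "('v, 'e) diagram \<Rightarrow> nat" where
  "num_crossings D = card (crossings D)"

definition num_vertices :: "('v, 'e) diagram \<Rightarrow> nat" where
  "num_vertices D = card (verts (graph D))"

definition num_edges :: "('v, 'e) diagram \<Rightarrow> nat" where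
  "num_edges D = card (arcs (graph D))"

text \<open>The ring of integer Laurent polynomials is the group ring of the integers.\<close>

type_synonym laurent = "int \<Rightarrow>\<^sub>0 int"

definition tpow :: "int \<Rightarrow> laurent" where
  "tpow k = Poly_Mapping.single k 1"

definition eval_laurent :: "int \<Rightarrow> laurent \<Rightarrow> rat" where
  "eval_laurent n q =
     (\<Sum>k \<in> Poly_Mapping.keys q. of_int (Poly_Mapping.lookup q k) * of_int n powi k)"

text \<open>
  If the understrand crosses the overarc from its right to its left, the arc to the right is the one
  before the undercrossing, otherwise it is the one after it.
\<close>

definition crossing_row :: "('v, 'e) diagram \<Rightarrow> ('e \<Rightarrow> int) \<Rightarrow> 'e crossing \<Rightarrow>
    'e diagram_arc \<Rightarrow> laurent" where
  "crossing_row D \<omega> x z =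
     (let ((e, s), (f, t)) = x;
          b = (e, unders_before D e s);
          before = (f, unders_before D f t);
          after = (f, unders_before D f t + 1);
          (a, c) = (if left_of (velocity D e s) (velocity D f t)
                    then (before, after) else (after, before))
      in of_bool (z = b) * (1 - tpow (\<omega> f)) + of_bool (z = c) * tpow (\<omega> e) - of_bool (z = a))"

definition end_exponent :: "('e \<Rightarrow> int) \<Rightarrow> 'e arc_end list \<Rightarrow> nat \<Rightarrow> int" where
  "end_exponent \<omega> xs i =
     (\<Sum>j<i. end_sign (xs ! j) * \<omega> (end_edge (xs ! j)))
     + min (end_sign (xs ! i)) 0 * \<omega> (end_edge (xs ! i))"

definition vertex_row :: "('v, 'e) diagram \<Rightarrow> ('e \<Rightarrow> int) \<Rightarrow> 'v \<Rightarrow> 'e diagram_arc \<Rightarrow> laurent" where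
  "vertex_row D \<omega> v z =
     (let xs = end_list D v
      in \<Sum>i<length xs. of_bool (z = end_arc D (xs ! i)) *
           (of_int (end_sign (xs ! i)) * tpow (end_exponent \<omega> xs i)))"

definition alexander_matrix :: "('v, 'e) diagram \<Rightarrow> ('e \<Rightarrow> int) \<Rightarrow> laurent mat" where
  "alexander_matrix D \<omega> = mat_of_rows_list (length (arc_list D))
     (map (\<lambda>x. map (crossing_row D \<omega> x) (arc_list D)) (crossing_list D) @
      map (\<lambda>v. map (vertex_row D \<omega> v) (arc_list D)) (vertex_list D))"

definition coloring_matrix :: "('v, 'e) diagram \<Rightarrow> ('e \<Rightarrow> int) \<Rightarrow> int \<Rightarrow> rat mat" where
  "coloring_matrix D \<omega> n = map_mat (eval_laurent n) (alexander_matrix D \<omega>)"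

abbreviation numer :: "rat \<Rightarrow> int" where "numer x \<equiv> fst (quotient_of x)"
abbreviation denom :: "rat \<Rightarrow> int" where "denom x \<equiv> snd (quotient_of x)"

text \<open>
  Negative powers of \<open>n\<close> make the entries rational. The greatest common divisor of a finite set of
  rationals is the nonnegative generator of the subgroup of the rationals they span; \<open>l\<close> is a
  common denominator. On a set of integers it is the usual one.
\<close>

definition rat_Gcd :: "rat set \<Rightarrow> rat" where
  "rat_Gcd S = (let l = Lcm (denom ` S)
                in of_int (Gcd ((\<lambda>x. numer (of_int l * x)) ` S)) / of_int l)"

definition minors :: "'a :: comm_ring_1 mat \<Rightarrow> nat \<Rightarrow> 'a set" where
  "minors A r = {Determinant.det (submatrix A I J) | I J.
     I \<subseteq> {..<dim_row A} \<and> J \<subseteq> {..<dim_col A} \<and> card I = r \<and> card J = r}"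

text \<open>If there are no minors of size \<open>k\<close>, the greatest common divisor is that of the empty set, 0.\<close>

definition gcd_minors :: "rat mat \<Rightarrow> int \<Rightarrow> rat" where
  "gcd_minors A k = (if k \<le> 0 then 1 else rat_Gcd (minors A (nat k)))"

definition det_at :: "('v, 'e) diagram \<Rightarrow> ('e \<Rightarrow> int) \<Rightarrow> nat \<Rightarrow> int \<Rightarrow> rat" where
  "det_at D \<omega> k n =
     gcd_minors (coloring_matrix D \<omega> n) (int (num_crossings D) + int (num_vertices D) - int k)"

text \<open>
  Rationals whose denominator is prime to \<open>p\<close> form a local ring with residue field of order \<open>p\<close>:
  such a rational is divisible by \<open>p\<close> iff its numerator is, and \<open>rat_mod\<close> is reduction modulo \<open>p\<close>.
\<close>

definition p_integral :: "nat \<Rightarrow> rat \<Rightarrow> bool" where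
  "p_integral p x \<longleftrightarrow> \<not> int p dvd denom x"

definition p_divides :: "nat \<Rightarrow> rat \<Rightarrow> bool" where
  "p_divides p x \<longleftrightarrow> p_integral p x \<and> int p dvd numer x"

definition rat_mod :: "rat \<Rightarrow> 'p :: prime_card mod_ring" where
  "rat_mod x = of_int (numer x) / of_int (denom x)"

definition colorings :: "('v, 'e) diagram \<Rightarrow> ('e \<Rightarrow> int) \<Rightarrow> int \<Rightarrow> 'p :: prime_card mod_ring vec set" where
  "colorings D \<omega> n = mat_kernel (map_mat rat_mod (coloring_matrix D \<omega> n))"

text \<open>The dimension of the space \<open>colorings\<close>: \<open>kernel_dim A\<close> is the dimension of \<open>mat_kernel A\<close>.\<close>

definition num_indep_colorings ::
    "'p :: prime_card itself \<Rightarrow> ('v, 'e) diagram \<Rightarrow> ('e \<Rightarrow> int) \<Rightarrow> int \<Rightarrow> nat" where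
  "num_indep_colorings P D \<omega> n =
     kernel_dim (map_mat rat_mod (coloring_matrix D \<omega> n) :: 'p mod_ring mat)"

end

theory Submission
  imports Defs "Jordan_Normal_Form.DL_Rank_Submatrix"
begin

text \<open>
  Let a diagram have \<open>c\<close> crossings, \<open>v\<close> vertices and \<open>e\<close> edges. Its coloring matrix \<open>A\<close> has \<open>c + v\<close>
  rows and \<open>c + e\<close> columns (\<open>coloring_matrix_carrier\<close>), so by the dimension formula it has nullity
  greater than \<open>e - v + k\<close> modulo \<open>p\<close> if and only if its rank modulo \<open>p\<close> is less than
  \<open>r = c + v - k\<close>. Over a field, the rank is less than \<open>r\<close> if and only if all minors of size \<open>r\<close>
  vanish (\<open>nullity_gt_iff_minors_vanish\<close>), which rests on the equality of row rank and column rank.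

  The entries of \<open>A\<close> lie in the ring of rationals whose denominator is prime to \<open>p\<close>: by hypothesis
  if \<open>p\<close> divides \<open>n\<close>, and otherwise because their denominators divide powers of \<open>n\<close>. Reduction modulo
  \<open>p\<close> is a ring homomorphism on this ring, so it takes the minors of \<open>A\<close> to the minors of the reduced
  matrix (\<open>minors_map_rat_mod\<close>). Hence all minors of size \<open>r\<close> vanish modulo \<open>p\<close> if and only if \<open>p\<close>
  divides every minor of \<open>A\<close> of size \<open>r\<close>, that is, if and only if it divides their greatest common
  divisor (\<open>p_divides_rat_Gcd\<close>), which is the \<open>k\<close>th determinant. A power of \<open>n\<close> as an additional factor
  is a unit of the ring if \<open>p\<close> does not divide \<open>n\<close>, and is 1 otherwise.
\<close>

section \<open>Nullity and minors over a field\<close>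

subsection \<open>The dimension formula\<close>

(* Leaves the bullet to the scalar product of vectors of variable dimension. *)
unbundle no inner_syntax

text \<open>The rank is the dimension of the span of the columns, which is the image of the map given by
  the matrix, so this is the dimension formula for that map.\<close>

lemma rank_plus_kernel_dim:
  fixes A :: "'a :: field mat"
  assumes A: "A \<in> carrier_mat nr nc"
  shows "vec_space.rank nr A + kernel_dim A = nc"
proof -
  interpret K: kernel nr nc A by unfold_locales (rule A)
  interpret NR: vec_space "TYPE('a)" nr .
  interpret T: linear_map class_ring "module_vec TYPE('a) nc" "module_vec TYPE('a) nr" "\<lambda>v. A *\<^sub>v v"
    using A by unfold_locales
      (auto simp: LinearCombinations.module_hom_def module_vec_simps class_ring_simps
        intro: mult_add_distrib_mat_vec mult_mat_vec)
  have "T.im = NR.span (set (cols A))"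
    using NR.col_space_eq[OF A] A
    by (auto simp: T.im_def NR.col_space_def module_vec_simps image_iff)
  moreover have "T.ker = mat_kernel A"
    using mat_kernel[OF A] by (auto simp: T.ker_def module_vec_simps)
  ultimately show ?thesis
    using T.rank_nullity A K.NC.dim_is_n K.NC.fin_dim by (simp add: NR.rank_def)
qed

subsection \<open>Row rank and column rank\<close>

lemma card_bounded_subset:
  "J \<subseteq> {..<n} \<Longrightarrow> card {j. j < n \<and> j \<in> J} = card J"
  by (metis (mono_tags, lifting) Collect_cong Collect_mem_eq lessThan_iff subset_iff)

lemma submatrix_carrier:
  "I \<subseteq> {..<dim_row A} \<Longrightarrow> J \<subseteq> {..<dim_col A} \<Longrightarrow>
     submatrix A I J \<in> carrier_mat (card I) (card J)"
  by (intro carrier_matI) (simp_all add: dim_submatrix card_bounded_subset)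

lemma pick_bounded:
  assumes "I \<subseteq> {..<n}" "i < card I"
  shows "pick I i < n"
  using pick_in_set_le[OF assms(2)] assms(1) by auto

lemma transpose_submatrix: "(submatrix A I J)\<^sup>T = submatrix A\<^sup>T J I"
  by (rule eq_matI) (auto simp: dim_submatrix submatrix_index pick_le)


text \<open>Independence is a property of the set of columns, whereas a minor is given by column indices
  and columns may repeat; one index is chosen for each vector of \<open>U\<close>.\<close>

lemma choose_column_indices:
  assumes "U \<subseteq> set (cols A)"
  obtains J where "J \<subseteq> {..<dim_col A}" "card J = card U"
    "set (cols (submatrix A UNIV J)) = U" "distinct (cols (submatrix A UNIV J))"
proof -
  have "\<forall>u\<in>U. \<exists>j<dim_col A. col A j = u"
    using assms by (metis cols_length cols_nth in_set_conv_nth subsetD)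
  then obtain f where f: "\<And>u. u \<in> U \<Longrightarrow> f u < dim_col A \<and> col A (f u) = u"
    by metis
  define J where "J = f ` U"
  have J: "J \<subseteq> {..<dim_col A}" using f by (auto simp: J_def)
  have "inj_on f U" by (metis f inj_onI)
  then have card: "card J = card U" by (simp add: J_def card_image)
  have fin: "finite J" using J finite_subset by blast
  let ?B = "submatrix A UNIV J"
  have len: "length (cols ?B) = card U"
    using J card by (simp add: dim_submatrix card_bounded_subset)
  have "col A j \<in> set (cols ?B)" if "j \<in> J" for j
  proof -
    let ?i = "card {a \<in> J. a < j}"
    have i: "?i < card J"
      using that fin by (auto intro!: psubset_card_mono)
    have "col ?B ?i = col A j"
      using that i J by (intro eq_vecI)
        (auto simp: dim_submatrix submatrix_index card_bounded_subset pick_UNIV pick_card_in_set)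
    then show ?thesis
      using i len card by (metis cols_length cols_nth nth_mem)
  qed
  then have sub: "U \<subseteq> set (cols ?B)"
    using f by (force simp: J_def)
  have "card (set (cols ?B)) = card U"
    using len sub by (metis List.finite_set card_length card_mono le_antisym)
  then have "set (cols ?B) = U" "distinct (cols ?B)"
    using sub len card_subset_eq[OF _ sub] by (auto intro: card_distinct)
  with J card show ?thesis by (rule that)
qed

lemma (in vec_space) maximal_indpt_spans:
  assumes S: "S \<subseteq> carrier_vec n" and max: "maximal U (\<lambda>T. T \<subseteq> S \<and> lin_indpt T)"
  shows "S \<subseteq> span U"
proof
  fix s assume s: "s \<in> S"
  have U: "U \<subseteq> S" "lin_indpt U" using max by (auto simp: maximal_def)
  show "s \<in> span U"
  proof (rule ccontr)
    assume n: "s \<notin> span U"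
    then have "s \<notin> U" using U S span_mem[of U s] by auto
    moreover have "lin_indpt (U \<union> {s})"
      using lin_dep_iff_in_span[of U s] U S s n \<open>s \<notin> U\<close> by auto
    ultimately show False
      using max s U unfolding maximal_def
      by (metis Un_subset_iff Un_upper1 Un_upper2 empty_subsetI insert_subset)
  qed
qed

lemma (in vec_space) maximal_indpt_columns:
  assumes A: "A \<in> carrier_mat n nc"
  obtains U where "maximal U (\<lambda>T. T \<subseteq> set (cols A) \<and> lin_indpt T)"
    "U \<subseteq> set (cols A)" "lin_indpt U" "rank A = card U"
proof -
  obtain U where max: "maximal U (\<lambda>T. T \<subseteq> set (cols A) \<and> lin_indpt T)"
    using maximal_exists_superset[of "set (cols A)" "\<lambda>T. T \<subseteq> set (cols A) \<and> lin_indpt T" "{}"]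
    by (auto simp: lin_dep_def)
  then have "U \<subseteq> set (cols A)" "lin_indpt U" by (simp_all add: maximal_def)
  with max rank_card_indpt[OF A max] show ?thesis by (intro that)
qed

lemma (in vec_space) rank_le_rows:
  assumes A: "A \<in> carrier_mat n nc"
  shows "rank A \<le> n"
proof -
  obtain U where "U \<subseteq> set (cols A)" "lin_indpt U" "rank A = card U"
    by (rule maximal_indpt_columns[OF A])
  then show ?thesis using li_le_dim[of U] cols_dim[of A] A dim_is_n by auto
qed

text \<open>Keeping only a maximal independent set of rows does not change the kernel, so by the
  dimension formula it does not change the rank either. The rank of what is left is at most
  its number of rows, which is the row rank.\<close>

lemma rank_le_rank_transpose:
  fixes A :: "'a :: field mat"
  assumes A: "A \<in> carrier_mat nr nc"
  shows "vec_space.rank nr A \<le> vec_space.rank nc A\<^sup>T"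
proof -
  interpret R: vec_space "TYPE('a)" nc .
  have At: "A\<^sup>T \<in> carrier_mat nc nr" using A by simp
  obtain U where max: "maximal U (\<lambda>T. T \<subseteq> set (cols A\<^sup>T) \<and> R.lin_indpt T)"
    and U: "U \<subseteq> set (cols A\<^sup>T)" and rank: "R.rank A\<^sup>T = card U"
    by (rule R.maximal_indpt_columns[OF At])
  from U obtain I where I: "I \<subseteq> {..<nr}" "card I = card U" and
    cols: "set (cols (submatrix A\<^sup>T UNIV I)) = U"
    using A by (elim choose_column_indices) auto
  define B where "B = submatrix A I UNIV"
  have B: "B \<in> carrier_mat (card U) nc"
    unfolding B_def using I A by (intro carrier_matI) (auto simp: dim_submatrix card_bounded_subset)
  have "B\<^sup>T = submatrix A\<^sup>T UNIV I" by (simp add: B_def transpose_submatrix)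
  then have rowsB: "set (rows B) = U" using cols by (metis cols_transpose)
  have rowsA: "set (rows A) \<subseteq> R.row_space B"
    using R.maximal_indpt_spans[OF _ max] At cols_dim[of "A\<^sup>T"]
    by (auto simp: R.row_space_def rowsB)
  (* A vector orthogonal to the chosen rows is orthogonal to their span, hence to every row. *)
  have "mat_kernel A = mat_kernel B"
  proof (intro subset_antisym subsetI)
    fix v assume "v \<in> mat_kernel A"
    then have v: "v \<in> carrier_vec nc" "A *\<^sub>v v = 0\<^sub>v nr" using A by (auto simp: mat_kernel)
    have "row B i \<bullet> v = 0" if "i < card U" for i
    proof -
      have "row B i = row A (pick I i)"
        unfolding B_def using that I A by (intro row_submatrix_UNIV) (simp add: card_bounded_subset)
      moreover have "pick I i < nr" using pick_bounded[OF I(1), of i] that I(2) by simp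
      ultimately show ?thesis using v A by (metis carrier_matD(1) index_mult_mat_vec index_zero_vec(1))
    qed
    then show "v \<in> mat_kernel B"
      using v B by (intro mat_kernelI[OF B]) auto
  next
    fix v assume "v \<in> mat_kernel B"
    then have v: "v \<in> carrier_vec nc" "B *\<^sub>v v = 0\<^sub>v (card U)" using B by (auto simp: mat_kernel)
    have "row A i \<bullet> v = 0" if "i < nr" for i
    proof -
      have "row A i \<in> R.row_space B" using rowsA A that by (auto simp: rows_def)
      then obtain y where y: "y \<in> carrier_vec (card U)" "B\<^sup>T *\<^sub>v y = row A i"
        using R.row_space_eq[OF B] B by auto
      have "row A i \<bullet> v = y \<bullet> (B *\<^sub>v v)"
        using transpose_vec_mult_scalar[OF B v(1) y(1)] y(2) by simp
      then show ?thesis using v y by simp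
    qed
    then show "v \<in> mat_kernel A"
      using v A by (intro mat_kernelI[OF A]) auto
  qed
  then have "kernel_dim A = kernel_dim B"
    using A B by (simp add: kernel_dim_def)
  then have "vec_space.rank nr A = vec_space.rank (card U) B"
    using rank_plus_kernel_dim[OF A] rank_plus_kernel_dim[OF B] by linarith
  also have "\<dots> \<le> card U" by (rule vec_space.rank_le_rows[OF B])
  finally show ?thesis using rank by simp
qed

lemma rank_transpose:
  fixes A :: "'a :: field mat"
  assumes A: "A \<in> carrier_mat nr nc"
  shows "vec_space.rank nc A\<^sup>T = vec_space.rank nr A"
  using rank_le_rank_transpose[OF A] rank_le_rank_transpose[of "A\<^sup>T" nc nr] A by simp

subsection \<open>Rank and minors\<close>

lemma full_rank_column_submatrix:
  fixes A :: "'a :: field mat"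
  assumes A: "A \<in> carrier_mat nr nc" and r: "r \<le> vec_space.rank nr A"
  obtains J where "J \<subseteq> {..<nc}" "card J = r" "vec_space.rank nr (submatrix A UNIV J) = r"
proof -
  interpret R: vec_space "TYPE('a)" nr .
  obtain S where S: "S \<subseteq> set (cols A)" "R.lin_indpt S" "R.rank A = card S"
    by (rule R.maximal_indpt_columns[OF A])
  obtain U where U: "U \<subseteq> S" "card U = r" using r S(3) by (metis obtain_subset_with_card_n)
  then have "R.lin_indpt U" using S R.subset_li_is_li by blast
  from U S obtain J where J: "J \<subseteq> {..<nc}" "card J = r"
    and cols: "set (cols (submatrix A UNIV J)) = U" "distinct (cols (submatrix A UNIV J))"
    using A choose_column_indices[of U A] by (metis carrier_matD(2) subset_trans)
  have "submatrix A UNIV J \<in> carrier_mat nr r"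
    using A J by (intro carrier_matI) (auto simp: dim_submatrix card_bounded_subset)
  then have "R.rank (submatrix A UNIV J) = r"
    using R.lin_indpt_full_rank cols \<open>R.lin_indpt U\<close> by blast
  with J show ?thesis by (rule that)
qed

lemma rank_ge_iff_minor:
  fixes A :: "'a :: field mat"
  assumes A: "A \<in> carrier_mat nr nc"
  shows "r \<le> vec_space.rank nr A \<longleftrightarrow> (\<exists>d \<in> minors A r. d \<noteq> 0)"
proof
  assume "r \<le> vec_space.rank nr A"
  then obtain J where J: "J \<subseteq> {..<nc}" "card J = r" and
    rk: "vec_space.rank nr (submatrix A UNIV J) = r"
    by (rule full_rank_column_submatrix[OF A])
  (* Independent columns are chosen first, then independent rows of the remaining matrix, whose
     row rank is still r. *)
  let ?B = "submatrix A UNIV J"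
  have B: "?B \<in> carrier_mat nr r"
    using A J by (intro carrier_matI) (auto simp: dim_submatrix card_bounded_subset)
  have Bt: "?B\<^sup>T \<in> carrier_mat r nr" using B by simp
  have "r \<le> vec_space.rank r ?B\<^sup>T" using rank_transpose[OF B] rk by simp
  then obtain I where I: "I \<subseteq> {..<nr}" "card I = r" and
    rk': "vec_space.rank r (submatrix ?B\<^sup>T UNIV I) = r"
    by (rule full_rank_column_submatrix[OF Bt])
  have eq: "submatrix ?B\<^sup>T UNIV I = (submatrix A I J)\<^sup>T"
    by (metis submatrix_split transpose_submatrix)
  have C: "submatrix A I J \<in> carrier_mat r r"
    using A I J submatrix_carrier[of I A J] by auto
  have "det (submatrix A I J) \<noteq> 0"
    using vec_space.det_rank_iff[of "(submatrix A I J)\<^sup>T" r] rk' C by (simp add: eq det_transpose[OF C])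
  then show "\<exists>d \<in> minors A r. d \<noteq> 0"
    using A I J by (auto simp: minors_def)
next
  assume "\<exists>d \<in> minors A r. d \<noteq> 0"
  then obtain I J where "J \<subseteq> {..<nc}" "card J = r" "det (submatrix A I J) \<noteq> 0"
    using A by (auto simp: minors_def)
  then show "r \<le> vec_space.rank nr A"
    using vec_space.rank_gt_minor[OF A, of I J] card_bounded_subset[of J nc] by simp
qed

lemma nullity_gt_iff_minors_vanish:
  fixes A :: "'a :: field mat"
  assumes A: "A \<in> carrier_mat nr nc"
  shows "nc < kernel_dim A + r \<longleftrightarrow> (\<forall>d \<in> minors A r. d = 0)"
  using rank_ge_iff_minor[OF A, of r] rank_plus_kernel_dim[OF A] by (auto simp: not_le[symmetric])


section \<open>Reduction of rationals modulo a prime\<close>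

text \<open>
  The predicates \<open>p_integral\<close> and \<open>p_divides\<close> and the map \<open>rat_mod\<close> refer to the reduced fraction.
  Sums and products of reduced fractions need not come out reduced, so each notion is shown to
  be computed correctly by any fraction whose denominator is prime to \<open>p\<close>.
\<close>

lemma numer_denom:
  assumes "x = of_int a / (of_int b :: rat)" "b \<noteq> 0"
  shows "a * denom x = numer x * b"
proof -
  have "of_int (numer x) / of_int (denom x) = x"
    using quotient_of_div[of x] by (cases "quotient_of x") auto
  then have "of_int a / of_int b = (of_int (numer x) / of_int (denom x) :: rat)" using assms by simp
  then have "of_int (a * denom x) = (of_int (numer x * b) :: rat)"
    using assms quotient_of_denom_pos'[of x] by (simp add: frac_eq_eq del: of_int_mult flip: of_int_mult)
  then show ?thesis by (simp only: of_int_eq_iff)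
qed

lemma p_integral_fraction:
  assumes "\<not> int p dvd b"
  shows "p_integral p (of_int a / of_int b)"
proof -
  let ?x = "of_int a / of_int b :: rat"
  have "a * denom ?x = numer ?x * b" using assms by (intro numer_denom) auto
  then have "denom ?x dvd numer ?x * b" by (metis dvd_triv_right)
  moreover have "coprime (numer ?x) (denom ?x)"
    using quotient_of_coprime[of ?x] by (cases "quotient_of ?x") auto
  ultimately have "denom ?x dvd b" by (simp add: coprime_commute coprime_dvd_mult_right_iff)
  then show ?thesis using assms dvd_trans by (auto simp: p_integral_def)
qed

lemma p_divides_fraction:
  assumes "prime p" "\<not> int p dvd b"
  shows "p_divides p (of_int a / of_int b) \<longleftrightarrow> int p dvd a"
proof -
  let ?x = "of_int a / of_int b :: rat"
  have "a * denom ?x = numer ?x * b" using assms by (intro numer_denom) auto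
  moreover have "\<not> int p dvd denom ?x"
    using p_integral_fraction[OF assms(2)] by (simp add: p_integral_def)
  moreover have "prime (int p)" using assms by simp
  ultimately have "int p dvd a \<longleftrightarrow> int p dvd numer ?x"
    using assms(2) by (metis prime_dvd_mult_iff)
  then show ?thesis using p_integral_fraction[OF assms(2)] by (simp add: p_divides_def)
qed

lemma p_integralE:
  assumes "p_integral p x"
  obtains a b where "x = of_int a / of_int b" "\<not> int p dvd b"
proof
  show "x = of_int (numer x) / of_int (denom x)"
    using quotient_of_div[of x] by (cases "quotient_of x") auto
  show "\<not> int p dvd denom x" using assms by (simp add: p_integral_def)
qed

subsection \<open>The local ring at the prime\<close>

lemma p_integral_of_int: "prime p \<Longrightarrow> p_integral p (of_int a)"
  using p_integral_fraction[of p 1 a] prime_gt_Suc_0_nat[of p] by auto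

lemma p_integral_add:
  assumes "prime p" "p_integral p x" "p_integral p y"
  shows "p_integral p (x + y)"
proof -
  from assms(2) obtain a b where x: "x = of_int a / of_int b" "\<not> int p dvd b" by (rule p_integralE)
  from assms(3) obtain c d where y: "y = of_int c / of_int d" "\<not> int p dvd d" by (rule p_integralE)
  have "x + y = of_int (a * d + c * b) / of_int (b * d)"
    using x y by (subst x(1), subst y(1), subst add_frac_eq) auto
  moreover have "\<not> int p dvd b * d" using x y assms(1) by (simp add: prime_dvd_mult_iff)
  ultimately show ?thesis using p_integral_fraction by metis
qed

lemma p_integral_mult:
  assumes "prime p" "p_integral p x" "p_integral p y"
  shows "p_integral p (x * y)"
proof -
  from assms(2) obtain a b where x: "x = of_int a / of_int b" "\<not> int p dvd b" by (rule p_integralE)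
  from assms(3) obtain c d where y: "y = of_int c / of_int d" "\<not> int p dvd d" by (rule p_integralE)
  have "x * y = of_int (a * c) / of_int (b * d)" using x y by simp
  moreover have "\<not> int p dvd b * d" using x y assms(1) by (simp add: prime_dvd_mult_iff)
  ultimately show ?thesis using p_integral_fraction by metis
qed

lemma p_integral_sum:
  assumes "prime p" "\<And>i. i \<in> I \<Longrightarrow> p_integral p (f i)"
  shows "p_integral p (sum f I)"
  using assms(2) p_integral_of_int[OF assms(1), of 0]
  by (induction I rule: infinite_finite_induct) (auto intro: p_integral_add assms(1))

lemma p_integral_prod:
  assumes "prime p" "\<And>i. i \<in> I \<Longrightarrow> p_integral p (f i)"
  shows "p_integral p (prod f I)"
  using assms(2) p_integral_of_int[OF assms(1), of 1]
  by (induction I rule: infinite_finite_induct) (auto intro: p_integral_mult assms(1))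

lemma index_in_elements_mat:
  "i < dim_row A \<Longrightarrow> j < dim_col A \<Longrightarrow> A $$ (i, j) \<in> elements_mat A"
  by (rule elements_matI) auto

lemma p_integral_det:
  assumes p: "prime p" and int: "\<And>x. x \<in> elements_mat A \<Longrightarrow> p_integral p x"
  shows "p_integral p (Determinant.det A)"
proof (cases "dim_row A = dim_col A")
  case True
  have "p_integral p (A $$ (i, \<pi> i))"
    if "\<pi> permutes {0..<dim_row A}" "i \<in> {0..<dim_row A}" for \<pi> i
    using that True permutes_in_image[OF that(1), of i]
    by (intro int index_in_elements_mat) auto
  then show ?thesis
    using True unfolding Determinant.det_def
    by (auto intro!: p_integral_sum p_integral_mult p_integral_prod p_integral_of_int p)
next
  case False
  then show ?thesis using p_integral_of_int[OF p, of 0] by (simp add: Determinant.det_def)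
qed

lemma p_divides_mult:
  assumes "prime p" "p_integral p x" "p_divides p y"
  shows "p_divides p (x * y)"
proof -
  from assms(2) obtain a b where x: "x = of_int a / of_int b" "\<not> int p dvd b" by (rule p_integralE)
  from assms(3) have "p_integral p y" by (simp add: p_divides_def)
  then obtain c d where y: "y = of_int c / of_int d" "\<not> int p dvd d" by (rule p_integralE)
  have "int p dvd c" using assms(1,3) y by (simp add: p_divides_fraction)
  moreover have "x * y = of_int (a * c) / of_int (b * d)" using x y by simp
  moreover have "\<not> int p dvd b * d" using x y assms(1) by (simp add: prime_dvd_mult_iff)
  ultimately show ?thesis using p_divides_fraction[OF assms(1)] by (metis dvd_mult)
qed

text \<open>This is why the determinants at \<open>n\<close> may be normalised by powers of \<open>n\<close>: these are units
  at every prime not dividing \<open>n\<close>.\<close>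

lemma p_divides_unit_mult:
  assumes "prime p" "p_integral p u" "p_integral p (inverse u)" "u \<noteq> 0"
  shows "p_divides p (u * y) \<longleftrightarrow> p_divides p y"
  using p_divides_mult[OF assms(1,2), of y] p_divides_mult[OF assms(1,3), of "u * y"] assms(4)
  by (auto simp: field_simps)

lemma p_integral_powi:
  assumes "prime p" "\<not> int p dvd n"
  shows "p_integral p (of_int n powi j)"
proof (cases "j \<ge> 0")
  case True
  then have "of_int n powi j = (of_int (n ^ nat j) :: rat)" by (simp add: power_int_def)
  then show ?thesis using p_integral_of_int[OF assms(1)] by metis
next
  case False
  then have "of_int n powi j = (of_int 1 / of_int (n ^ nat (- j)) :: rat)"
    by (simp add: power_int_def field_simps)
  moreover have "\<not> int p dvd n ^ nat (- j)" using assms prime_dvd_power[of "int p"] by auto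
  ultimately show ?thesis using p_integral_fraction by metis
qed

lemma p_integral_eval_laurent:
  assumes "prime p" "\<not> int p dvd n"
  shows "p_integral p (eval_laurent n q)"
  unfolding eval_laurent_def
  by (intro p_integral_sum p_integral_mult p_integral_of_int p_integral_powi assms)

lemma not_dvd_Lcm:
  assumes "prime (p :: int)" "finite T" "\<And>b. b \<in> T \<Longrightarrow> \<not> p dvd b"
  shows "\<not> p dvd Lcm T"
  using assms(2,3)
proof (induction T)
  case empty
  then show ?case using prime_gt_1_int[OF assms(1)] by simp
next
  case (insert b T)
  have "lcm b (Lcm T) dvd b * Lcm T" by simp
  then show ?case using insert assms(1) by (metis Lcm_insert dvd_trans insertCI prime_dvd_mult_iff)
qed

text \<open>A common denominator \<open>l\<close> of the elements of \<open>S\<close> is again prime to \<open>p\<close>. Over this denominator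
  divisibility by \<open>p\<close> is divisibility of integer numerators, where it passes to the greatest common
  divisor. An empty \<open>S\<close> has greatest common divisor 0, which \<open>p\<close> divides.\<close>

lemma p_divides_rat_Gcd:
  assumes p: "prime p" and S: "finite S" "\<And>x. x \<in> S \<Longrightarrow> p_integral p x"
  shows "p_divides p (rat_Gcd S) \<longleftrightarrow> (\<forall>x\<in>S. p_divides p x)"
proof -
  define l where "l = Lcm (denom ` S)"
  have l: "\<not> int p dvd l"
    unfolding l_def using p S by (intro not_dvd_Lcm) (auto simp: p_integral_def)
  then have "l \<noteq> 0" by auto
  define num where "num x = numer (of_int l * x)" for x
  have num: "x = of_int (num x) / of_int l" if x: "x \<in> S" for x
  proof -
    have "denom x dvd l" unfolding l_def using x by simp
    then obtain k where k: "l = denom x * k" by (rule dvdE)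
    have "x = of_int (numer x) / of_int (denom x)"
      using quotient_of_div[of x] by (cases "quotient_of x") auto
    then have "of_int l * x = of_int (k * numer x)"
      unfolding k using quotient_of_denom_pos'[of x] by (simp add: field_simps)
    moreover from this have "num x = k * numer x" unfolding num_def by (metis quotient_of_rat_of_int fst_conv)
    ultimately show ?thesis using \<open>l \<noteq> 0\<close> by (simp add: field_simps)
  qed
  have "rat_Gcd S = of_int (Gcd (num ` S)) / of_int l"
    by (simp add: rat_Gcd_def Let_def l_def num_def)
  then have "p_divides p (rat_Gcd S) \<longleftrightarrow> int p dvd Gcd (num ` S)"
    using p_divides_fraction[OF p l] by simp
  also have "\<dots> \<longleftrightarrow> (\<forall>x\<in>S. int p dvd num x)" by (auto simp: dvd_Gcd_iff)
  also have "\<dots> \<longleftrightarrow> (\<forall>x\<in>S. p_divides p x)"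
    using num p_divides_fraction[OF p l] by metis
  finally show ?thesis .
qed

subsection \<open>The residue map\<close>

lemma of_int_mod_ring_eq_0_iff:
  "(of_int a :: 'p :: prime_card mod_ring) = 0 \<longleftrightarrow> int CARD('p) dvd a"
  by (transfer, auto simp: mod_eq_0_iff_dvd)

lemma rat_mod_fraction:
  assumes "\<not> int CARD('p) dvd b"
  shows "rat_mod (of_int a / of_int b) = (of_int a / of_int b :: 'p :: prime_card mod_ring)"
proof -
  let ?x = "of_int a / of_int b :: rat"
  have "a * denom ?x = numer ?x * b" using assms by (intro numer_denom) auto
  then have "of_int a * of_int (denom ?x) = (of_int (numer ?x) * of_int b :: 'p mod_ring)"
    by (metis of_int_mult)
  moreover have "\<not> int CARD('p) dvd denom ?x"
    using p_integral_fraction[OF assms] by (simp add: p_integral_def)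
  ultimately show ?thesis
    using assms by (simp add: rat_mod_def frac_eq_eq of_int_mod_ring_eq_0_iff)
qed

lemma rat_mod_of_int: "rat_mod (of_int a) = (of_int a :: 'p :: prime_card mod_ring)"
  using rat_mod_fraction[where 'p = 'p, of 1 a] prime_gt_Suc_0_nat[OF prime_card[where 'a = 'p]]
  by auto

lemma rat_mod_eq_0_iff:
  assumes "p_integral CARD('p) x"
  shows "(rat_mod x :: 'p :: prime_card mod_ring) = 0 \<longleftrightarrow> p_divides CARD('p) x"
  using assms unfolding rat_mod_def p_divides_def p_integral_def
  by (auto simp: of_int_mod_ring_eq_0_iff)

lemma rat_mod_add:
  assumes "p_integral CARD('p) x" "p_integral CARD('p) y"
  shows "rat_mod (x + y) = (rat_mod x + rat_mod y :: 'p :: prime_card mod_ring)"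
proof -
  let ?p = "int CARD('p)"
  from assms(1) obtain a b where x: "x = of_int a / of_int b" "\<not> ?p dvd b" by (rule p_integralE)
  from assms(2) obtain c d where y: "y = of_int c / of_int d" "\<not> ?p dvd d" by (rule p_integralE)
  have "x + y = of_int (a * d + c * b) / of_int (b * d)"
    using x y by (subst x(1), subst y(1), subst add_frac_eq) auto
  moreover have "\<not> ?p dvd b * d"
    using x y prime_card_int[where 'a = 'p] by (simp add: prime_dvd_mult_iff)
  ultimately have "rat_mod (x + y) = (of_int (a * d + c * b) / of_int (b * d) :: 'p mod_ring)"
    by (metis rat_mod_fraction)
  also have "\<dots> = of_int a / of_int b + of_int c / of_int d"
    using x y by (subst add_frac_eq) (auto simp: of_int_mod_ring_eq_0_iff)
  finally show ?thesis using x y by (simp add: rat_mod_fraction)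
qed

lemma rat_mod_mult:
  assumes "p_integral CARD('p) x" "p_integral CARD('p) y"
  shows "rat_mod (x * y) = (rat_mod x * rat_mod y :: 'p :: prime_card mod_ring)"
proof -
  let ?p = "int CARD('p)"
  from assms(1) obtain a b where x: "x = of_int a / of_int b" "\<not> ?p dvd b" by (rule p_integralE)
  from assms(2) obtain c d where y: "y = of_int c / of_int d" "\<not> ?p dvd d" by (rule p_integralE)
  have "x * y = of_int (a * c) / of_int (b * d)" using x y by simp
  moreover have "\<not> ?p dvd b * d"
    using x y prime_card_int[where 'a = 'p] by (simp add: prime_dvd_mult_iff)
  ultimately have "rat_mod (x * y) = (of_int (a * c) / of_int (b * d) :: 'p mod_ring)"
    by (metis rat_mod_fraction)
  then show ?thesis using x y by (simp add: rat_mod_fraction)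
qed

lemma rat_mod_sum:
  assumes "\<And>i. i \<in> I \<Longrightarrow> p_integral CARD('p) (f i)"
  shows "rat_mod (sum f I) = (\<Sum>i\<in>I. rat_mod (f i) :: 'p :: prime_card mod_ring)"
  using assms
proof (induction I rule: infinite_finite_induct)
  case (insert i I)
  then show ?case using prime_card[where 'a = 'p]
    by (simp add: rat_mod_add p_integral_sum)
qed (use rat_mod_of_int[where 'p = 'p, of 0] in auto)

lemma rat_mod_prod:
  assumes "\<And>i. i \<in> I \<Longrightarrow> p_integral CARD('p) (f i)"
  shows "rat_mod (prod f I) = (\<Prod>i\<in>I. rat_mod (f i) :: 'p :: prime_card mod_ring)"
  using assms
proof (induction I rule: infinite_finite_induct)
  case (insert i I)
  then show ?case using prime_card[where 'a = 'p]
    by (simp add: rat_mod_mult p_integral_prod)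
qed (use rat_mod_of_int[where 'p = 'p, of 1] in auto)

text \<open>The determinant is a polynomial in the entries with coefficients \<open>1\<close> and \<open>-1\<close>, so it commutes
  with the residue map, which is a ring homomorphism on the local ring.\<close>

lemma det_map_rat_mod:
  assumes int: "\<And>x. x \<in> elements_mat A \<Longrightarrow> p_integral CARD('p) x"
  shows "Determinant.det (map_mat rat_mod A) = (rat_mod (Determinant.det A) :: 'p :: prime_card mod_ring)"
proof (cases "dim_row A = dim_col A")
  case False
  then show ?thesis
    using rat_mod_of_int[where 'p = 'p, of 0] by (simp add: Determinant.det_def)
next
  case True
  let ?n = "dim_row A" and ?P = "{\<pi>. \<pi> permutes {0..<dim_row A}}"
  have p: "prime CARD('p)" by (rule prime_card)
  have entry: "p_integral CARD('p) (A $$ (i, \<pi> i))" if "\<pi> \<in> ?P" "i \<in> {0..<?n}" for \<pi> i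
    using that True permutes_in_image[of \<pi> "{0..<?n}" i] by (intro int index_in_elements_mat) auto
  have "rat_mod (Determinant.det A) =
      (\<Sum>\<pi>\<in>?P. rat_mod (of_int (sign \<pi>) * (\<Prod>i=0..<?n. A $$ (i, \<pi> i))) :: 'p mod_ring)"
    unfolding Determinant.det_def using True
    by (simp, subst rat_mod_sum)
      (auto intro!: p_integral_mult p_integral_prod p_integral_of_int p entry)
  also have "\<dots> = (\<Sum>\<pi>\<in>?P. of_int (sign \<pi>) * (\<Prod>i=0..<?n. rat_mod (A $$ (i, \<pi> i))))"
  proof (intro sum.cong refl)
    fix \<pi> assume \<pi>: "\<pi> \<in> ?P"
    have "rat_mod (\<Prod>i=0..<?n. A $$ (i, \<pi> i)) =
        (\<Prod>i=0..<?n. rat_mod (A $$ (i, \<pi> i)) :: 'p mod_ring)"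
      by (intro rat_mod_prod entry \<pi>)
    moreover have "p_integral CARD('p) (\<Prod>i=0..<?n. A $$ (i, \<pi> i))"
      by (intro p_integral_prod p entry \<pi>)
    ultimately show "rat_mod (of_int (sign \<pi>) * (\<Prod>i=0..<?n. A $$ (i, \<pi> i))) =
        (of_int (sign \<pi>) * (\<Prod>i=0..<?n. rat_mod (A $$ (i, \<pi> i))) :: 'p mod_ring)"
      by (simp only: rat_mod_mult p_integral_of_int[OF p] rat_mod_of_int)
  qed
  also have "\<dots> = Determinant.det (map_mat rat_mod A)"
    unfolding Determinant.det_def using True permutes_in_image
    by (auto intro!: sum.cong prod.cong simp: permutes_in_image)
  finally show ?thesis by simp
qed

section \<open>Nullity modulo a prime and the greatest common divisor of minors\<close>

lemma submatrix_map_mat: "submatrix (map_mat f A) I J = map_mat f (submatrix A I J)"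
  by (rule eq_matI) (auto simp: dim_submatrix submatrix_index pick_le)

lemma elements_submatrix: "elements_mat (submatrix A I J) \<subseteq> elements_mat A"
  unfolding elements_mat_def[of "submatrix A I J"]
  by (auto simp: dim_submatrix submatrix_index intro!: index_in_elements_mat pick_le)

lemma finite_minors: "finite (minors A r)"
proof -
  have "minors A r \<subseteq> (\<lambda>(I, J). Determinant.det (submatrix A I J)) `
      (Pow {..<dim_row A} \<times> Pow {..<dim_col A})"
    by (auto simp: minors_def)
  then show ?thesis by (rule finite_subset) auto
qed

lemma minors_map_rat_mod:
  assumes int: "\<And>x. x \<in> elements_mat A \<Longrightarrow> p_integral CARD('p) x"
  shows "minors (map_mat rat_mod A) r = (rat_mod ` minors A r :: 'p :: prime_card mod_ring set)"
proof -
  have "Determinant.det (submatrix (map_mat rat_mod A) I J) =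
      (rat_mod (Determinant.det (submatrix A I J)) :: 'p mod_ring)" for I J
    unfolding submatrix_map_mat
    using int elements_submatrix[of A I J] by (intro det_map_rat_mod) auto
  then show ?thesis by (auto simp: minors_def image_iff)
qed

lemma nullity_mod_gt_iff_p_divides_gcd:
  fixes A :: "rat mat"
  assumes A: "A \<in> carrier_mat nr nc"
    and int: "\<And>x. x \<in> elements_mat A \<Longrightarrow> p_integral CARD('p) x"
  shows "nc < kernel_dim (map_mat rat_mod A :: 'p :: prime_card mod_ring mat) + r
    \<longleftrightarrow> p_divides CARD('p) (rat_Gcd (minors A r))"
proof -
  have minor: "p_integral CARD('p) d" if "d \<in> minors A r" for d
  proof -
    from that obtain I J where "d = Determinant.det (submatrix A I J)" by (auto simp: minors_def)
    then show ?thesis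
      by (metis int subsetD[OF elements_submatrix] p_integral_det prime_card)
  qed
  have "nc < kernel_dim (map_mat rat_mod A :: 'p mod_ring mat) + r \<longleftrightarrow>
      (\<forall>d \<in> minors A r. (rat_mod d :: 'p mod_ring) = 0)"
    using A nullity_gt_iff_minors_vanish[of "map_mat rat_mod A :: 'p mod_ring mat" nr nc r]
    by (simp add: minors_map_rat_mod int)
  also have "\<dots> \<longleftrightarrow> (\<forall>d \<in> minors A r. p_divides CARD('p) d)"
    using minor by (simp add: rat_mod_eq_0_iff)
  also have "\<dots> \<longleftrightarrow> p_divides CARD('p) (rat_Gcd (minors A r))"
    using p_divides_rat_Gcd[OF prime_card[where 'a = 'p] finite_minors minor] by simp
  finally show ?thesis .
qed

section \<open>The shape of the coloring matrix\<close>

text \<open>An edge with \<open>m\<close> undercrossings is cut into \<open>m + 1\<close> arcs, and each crossing is an undercrossing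
  of exactly one edge.\<close>

lemma card_diagram_arcs:
  assumes "finite (arcs (graph D))" "finite (crossings D)"
  shows "card (diagram_arcs D) = num_crossings D + num_edges D"
proof -
  let ?under = "\<lambda>e. {x \<in> crossings D. fst (snd x) = e}"
  have param: "fst (snd x) \<in> arcs (graph D)" "snd (snd x) < 1" if "x \<in> crossings D" for x
    using that by (auto simp: crossings_def strands_def)
  then have before: "unders_before D e 1 = card (?under e)" for e
    unfolding unders_before_def by (intro arg_cong[of _ _ card]) auto
  have "diagram_arcs D = (SIGMA e:arcs (graph D). {..unders_before D e 1})"
    by (auto simp: diagram_arcs_def)
  then have "card (diagram_arcs D) = (\<Sum>e\<in>arcs (graph D). card (?under e) + 1)"
    using assms by (simp add: before)
  also have "\<dots> = (\<Sum>e\<in>arcs (graph D). card (?under e)) + num_edges D"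
    unfolding sum.distrib num_edges_def by simp
  also have "(\<Sum>e\<in>arcs (graph D). card (?under e)) = card (\<Union>e\<in>arcs (graph D). ?under e)"
    using assms by (intro card_UN_disjoint[symmetric]) auto
  also have "(\<Union>e\<in>arcs (graph D). ?under e) = crossings D" using param by auto
  finally show ?thesis by (simp add: num_crossings_def)
qed

lemma coloring_matrix_carrier:
  assumes D: "is_diagram D"
  shows "coloring_matrix D \<omega> n
    \<in> carrier_mat (num_crossings D + num_vertices D) (num_crossings D + num_edges D)"
proof -
  have fin: "finite (arcs (graph D))" "finite (crossings D)"
    using D by (auto simp: is_diagram_def is_spatial_graph_def regular_projection_def
      fin_digraph_def fin_digraph_axioms_def)
  have "length (arc_list D) = num_crossings D + num_edges D"
    using D card_diagram_arcs[OF fin] by (metis is_diagram_def distinct_card)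
  moreover have "length (crossing_list D) = num_crossings D"
    using D by (metis is_diagram_def distinct_card num_crossings_def)
  moreover have "length (vertex_list D) = num_vertices D"
    using D by (metis is_diagram_def distinct_card num_vertices_def)
  ultimately show ?thesis
    by (auto simp: coloring_matrix_def alexander_matrix_def mat_of_rows_list_def)
qed

section \<open>Colorings and determinants\<close>

theorem theorem2:
  fixes D :: "('v, 'e) diagram" and \<omega> :: "'e \<Rightarrow> int" and n j :: int and p k :: nat
  assumes "is_diagram D" and "balanced (graph D) \<omega>"
    and "n \<noteq> 0"
    and "prime p" and "odd p" and "p = CARD('p :: prime_card)"
    and "int k \<le> int (num_crossings D) + int (num_vertices D) - 1"
    and "int p dvd n \<Longrightarrow> j = 0 \<and> (\<forall>x \<in> elements_mat (coloring_matrix D \<omega> n). p_integral p x)"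
  shows "int (num_indep_colorings TYPE('p) D \<omega> n)
           > int (num_edges D) - int (num_vertices D) + int k
         \<longleftrightarrow> p_divides p (of_int n powi j * det_at D \<omega> k n)"
proof -
  let ?A = "coloring_matrix D \<omega> n"
  define r where "r = num_crossings D + num_vertices D - k"
  have r: "int r = int (num_crossings D) + int (num_vertices D) - int k" "r > 0"
    using assms(7) by (auto simp: r_def)
  have int: "p_integral p x" if x: "x \<in> elements_mat ?A" for x
  proof (cases "int p dvd n")
    case True
    then show ?thesis using assms(8) x by blast
  next
    case False
    from x obtain q where "x = eval_laurent n q"
      by (auto simp: coloring_matrix_def elements_mat_def)
    then show ?thesis using False assms(4) p_integral_eval_laurent by simp
  qed
  have "int (num_indep_colorings TYPE('p) D \<omega> n) > int (num_edges D) - int (num_vertices D) + int k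
      \<longleftrightarrow> num_crossings D + num_edges D < num_indep_colorings TYPE('p) D \<omega> n + r"
    using r(1) by linarith
  also have "\<dots> \<longleftrightarrow> p_divides p (rat_Gcd (minors ?A r))"
    unfolding num_indep_colorings_def
    using nullity_mod_gt_iff_p_divides_gcd[where 'p = 'p, OF coloring_matrix_carrier[OF assms(1)], of \<omega> n r]
      int assms(6) by simp
  also have "rat_Gcd (minors ?A r) = det_at D \<omega> k n"
    using r(2) by (simp add: det_at_def gcd_minors_def flip: r(1))
  also have "p_divides p (det_at D \<omega> k n) \<longleftrightarrow> p_divides p (of_int n powi j * det_at D \<omega> k n)"
  proof (cases "int p dvd n")
    case True
    then show ?thesis using assms(8) by simp
  next
    case False
    then show ?thesis
      using p_divides_unit_mult[OF assms(4), of "of_int n powi j"] assms(3,4)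
        p_integral_powi[OF assms(4) False, of j] p_integral_powi[OF assms(4) False, of "- j"]
      by (simp add: power_int_minus)
  qed
  finally show ?thesis .
qed

end
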